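(* Let $G$ be a connected graph whose $2$-connected components (blocks) are of negative type, that is, for every block $B$ of $G$ the graphic metric space $(V(B),d_B)$ is of negative type. If $D(G)$ is the distance matrix of $G$, then $D(G)$ has exactly one positive eigenvalue.
   Context: Graphs are finite, undirected, simple and loopless. For a connected graph $H$, $d_H(u,v)$ denotes the length of a shortest path between $u$ and $v$ in $H$; $(V(H),d_H)$ is the graphic metric space of $H$, and the distance matrix $D(H)$ is the matrix $(d_H(u,v))_{u,v\in V(H)}$. A block ($2$-connected component) of $G$ is a maximal connected subgraph of $G$ which has no cut vertices (of itself); thus a block is either a maximal $2$-connected subgraph, or a cut-edge, or an isolated vertex. A metric space $(X,d)$, with $X$ finite, is of negative type if for every function $w:X\to\mathbb{Z}$ with $\sum_{x\in X}w(x)=0$ one has $\sum_{x\in X}\sum_{y\in X}w(x)w(y)d(x,y)\le 0$.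
   Formalization: The graph G is assumed to have at least two vertices; for the one-vertex graph the distance matrix is (0), which has no positive eigenvalue, so the claim fails there. *)

theory Defs
  imports
    "Graph_Theory.Graph_Theory"
    "Jordan_Normal_Form.Char_Poly"
begin

text \<open>
  Finite simple undirected graphs are rendered by the locale \<open>graph\<close> of \<open>Graph_Theory\<close>:
  finite symmetric digraphs without loops and without parallel arcs.
\<close>

text \<open>
  The function \<open>wf_digraph.\<mu>\<close> is the infimum, in \<open>ereal\<close>, of the costs of all walks from
  \<open>u\<close> to \<open>v\<close>. With unit costs it is the length of a shortest path (see \<open>graph_dist_shortest_path\<close>
  below). Between vertices that are not connected it is infinite, and \<open>graph_dist\<close> is then \<open>0\<close>;
  this never occurs in a connected graph.
\<close>

definition graph_dist :: "('a, 'b) pre_digraph \<Rightarrow> 'a \<Rightarrow> 'a \<Rightarrow> real" where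
  "graph_dist H u v = real_of_ereal (wf_digraph.\<mu> H (\<lambda>_. 1) u v)"

text \<open>
  In a symmetric digraph the strongly connected components are the connected components.
  The empty graph has none, so the vertex of a one-vertex graph is not a cut vertex.
\<close>

definition cut_vertex :: "('a, 'b) pre_digraph \<Rightarrow> 'a \<Rightarrow> bool" where
  "cut_vertex H v \<longleftrightarrow> v \<in> verts H \<and>
     card (pre_digraph.sccs_verts H) < card (pre_digraph.sccs_verts (pre_digraph.del_vert H v))"

text \<open>
  The library's \<open>subgraph\<close> relation ranges over all subdigraphs; \<open>graph H\<close> restricts it to the
  symmetric ones, that is, to subgraphs in the undirected sense.
\<close>

definition block :: "('a, 'b) pre_digraph \<Rightarrow> ('a, 'b) pre_digraph \<Rightarrow> bool" where
  "block G B \<longleftrightarrow> pre_digraph.max_subgraph G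
     (\<lambda>H. graph H \<and> Digraph_Component.connected H \<and> (\<forall>v\<in>verts H. \<not> cut_vertex H v)) B"

definition negative_type :: "'a set \<Rightarrow> ('a \<Rightarrow> 'a \<Rightarrow> real) \<Rightarrow> bool" where
  "negative_type X d \<longleftrightarrow> (\<forall>w :: 'a \<Rightarrow> int. (\<Sum>x\<in>X. w x) = 0 \<longrightarrow>
     (\<Sum>x\<in>X. \<Sum>y\<in>X. of_int (w x) * of_int (w y) * d x y) \<le> 0)"

text \<open>
  Rows and columns are indexed along an enumeration \<open>vs\<close> of the vertices.
\<close>

definition distance_matrix :: "('a, 'b) pre_digraph \<Rightarrow> 'a list \<Rightarrow> real mat" where
  "distance_matrix H vs =
     Matrix.mat (length vs) (length vs) (\<lambda>(i, j). graph_dist H (vs ! i) (vs ! j))"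

text \<open>
  Positive eigenvalues counted with algebraic multiplicity.
\<close>

definition num_pos_eigenvalues :: "real mat \<Rightarrow> nat" where
  "num_pos_eigenvalues A =
     (\<Sum>k | eigenvalue A k \<and> 0 < k. Polynomial.order k (char_poly A))"

lemma graph_dist_shortest_path:
  assumes "fin_digraph H" and "u \<rightarrow>\<^sup>*\<^bsub>H\<^esub> v"
  shows "\<exists>p. pre_digraph.apath H u p v \<and> graph_dist H u v = real (length p) \<and>
    (\<forall>q. pre_digraph.awalk H u q v \<longrightarrow> length p \<le> length q)"
proof -
  interpret fin_digraph H by fact
  have cost: "awalk_cost (\<lambda>_. 1) p = real (length p)" for p
    by (induction p) simp_all
  obtain p where p: "apath u p v" and d: "\<mu> (\<lambda>_. 1) u v = ereal (real (length p))"
    using min_cost_awalk[OF assms(2), of "\<lambda>_. 1"] by (auto simp: cost)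
  have "length p \<le> length q" if "awalk u q v" for q
    using min_cost_le_walk_cost[OF that, of "\<lambda>_. 1"] by (simp add: d cost)
  with p d show ?thesis by (auto simp: graph_dist_def)
qed

end

theory Submission
  imports Defs "Jordan_Normal_Form.Schur_Decomposition"
begin

text \<open>
  Negative type says that the quadratic form of the distance matrix is nonpositive on the
  hyperplane of vectors with coordinate sum zero. A symmetric matrix with this property has at
  most one positive eigenvalue, since two of them would span a plane on which the form is positive
  definite, and such a plane meets the hyperplane (\<open>num_pos_eigenvalues_le_1\<close>). A distance matrix
  of a graph with at least two vertices is nonzero and has trace zero, so it cannot have only
  nonpositive eigenvalues (\<open>num_pos_eigenvalues_pos\<close>). What remains is to pass from the blocks to
  the whole graph (\<open>negative_type_of_blocks\<close>).

  Suppose that a cut vertex \<open>v\<close> splits a connected graph into two sides that share only \<open>v\<close>.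
  Each side is a retract of the graph: send the other side to \<open>v\<close>. Every edge lies in exactly one side, so
  a shortest path splits into a path in each side, and the distance of two vertices is the sum
  of the distances of their images in the two sides (\<open>graph_dist_separation\<close>). Negative type is
  preserved by pulling a distance back along a map and by sums, so it passes from the two sides
  to the whole. Splitting repeatedly ends in pieces without cut vertices. To know that these
  pieces really are blocks of the original graph, the induction runs over vertex sets that
  contain every cut-free connected subgraph meeting them in two or more vertices; both sides
  of a separation inherit this (\<open>block_closed_separation\<close>).

  Negative type is defined with integer weights; real weights follow by approximation
  (\<open>negative_type_real_weights\<close>). Counting eigenvalues with algebraic multiplicity calls for some
  spectral theory, for which a Schur triangularization is enough.
\<close>

section \<open>Cut vertices and separations\<close>

text \<open>
  No edge that avoids \<open>v\<close> crosses between \<open>A\<close> and its complement. The vertex \<open>v\<close> may lie outside \<open>K\<close>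
  and \<open>A\<close> may contain anything, so that the property passes to subgraphs without adjusting \<open>A\<close>.
\<close>

definition separates :: "('a, 'b) pre_digraph \<Rightarrow> 'a \<Rightarrow> 'a set \<Rightarrow> bool" where
  "separates K v A \<longleftrightarrow> (\<forall>e\<in>arcs K. tail K e \<noteq> v \<longrightarrow> head K e \<noteq> v \<longrightarrow> (tail K e \<in> A \<longleftrightarrow> head K e \<in> A))"

lemma (in graph) graph_induce_subgraph:
  assumes "S \<subseteq> verts G"
  shows "graph (G \<restriction> S)"
proof -
  have ind: "induced_subgraph (G \<restriction> S) G" using assms by (rule induced_induce)
  interpret D: digraph "G \<restriction> S" using ind by (rule digraphI_induced)
  have "symmetric (G \<restriction> S)" using sym_arcs ind by (rule induced_graph_imp_symmetric)
  then show ?thesis by (rule D.graphI)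
qed

lemma (in graph) graph_del_vert: "graph (del_vert v)"
proof -
  have "del_vert v = G \<restriction> (verts G - {v})"
    by (auto simp: del_vert_def induce_subgraph_def)
  then show ?thesis using graph_induce_subgraph[of "verts G - {v}"] by simp
qed

lemma (in graph) connected_iff:
  "Digraph_Component.connected G \<longleftrightarrow> verts G \<noteq> {} \<and> (\<forall>u\<in>verts G. \<forall>w\<in>verts G. u \<rightarrow>\<^sup>* w)"
  by (simp add: connected_def strongly_connected_def reachable_mk_symmetric_eq sym_arcs)

lemma (in wf_digraph) closed_under_reachability:
  assumes "\<And>e. e \<in> arcs G \<Longrightarrow> tail G e \<in> A \<Longrightarrow> head G e \<in> A"
    and "x \<rightarrow>\<^sup>* y" and "x \<in> A"
  shows "y \<in> A"
  using assms(2,3)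
proof (induction rule: converse_reachable_induct)
  case (step u w)
  then show ?case using assms(1) by (auto simp: arcs_ends_conv)
qed

text \<open>
  This trades the count of components for a two-sided partition, which is the form in which
  cut vertices are used below. From left to right, \<open>A\<close> is one of the components that remain after
  deleting \<open>v\<close>; conversely no walk avoiding \<open>v\<close> leaves \<open>A\<close>, so at least two components remain,
  while \<open>G\<close> itself has only one.
\<close>

lemma (in graph) cut_vertex_iff:
  assumes "Digraph_Component.connected G"
  shows "cut_vertex G v \<longleftrightarrow> v \<in> verts G \<and>
    (\<exists>A. separates G v A \<and> (verts G - {v}) \<inter> A \<noteq> {} \<and> verts G - {v} - A \<noteq> {})"
proof (cases "v \<in> verts G")
  case v: True
  \<comment> \<open>\<open>K\<close> prefixes the components of \<open>G\<close> minus \<open>v\<close>; unprefixed names refer to \<open>G\<close>\<close>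
  interpret K: graph "del_vert v" by (rule graph_del_vert)
  have reach: "u \<rightarrow>\<^sup>* w" if "u \<in> verts G" "w \<in> verts G" for u w
    using assms that by (auto simp: connected_iff)
  have "scc_of u = verts G" if "u \<in> verts G" for u
    unfolding scc_of_def using that reach by (blast dest: reachable_in_verts)
  with v have "sccs_verts = {verts G}"
    by (auto simp: sccs_verts_conv_scc_of image_iff)
  then have one: "card sccs_verts = 1" by simp
  show ?thesis
  proof
    assume "cut_vertex G v"
    then have "1 < card K.sccs_verts" using one by (simp add: cut_vertex_def)
    then obtain C D where C: "C \<in> K.sccs_verts" and D: "D \<in> K.sccs_verts" and "C \<noteq> D"
      by (metis One_nat_def card_le_Suc0_iff_eq K.finite_sccs_verts not_less)
    from C D obtain x y where x: "x \<in> verts G - {v}" "C = K.scc_of x"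
      and y: "y \<in> verts G - {v}" "D = K.scc_of y"
      by (auto simp: K.sccs_verts_conv_scc_of del_vert_simps)
    let ?A = "K.scc_of x"
    have "y \<notin> ?A" using K.scc_of_eq \<open>C \<noteq> D\<close> x y by auto
    moreover have "x \<in> ?A" using x by (intro K.in_scc_of_self) (simp add: del_vert_simps)
    moreover have "separates G v ?A"
      unfolding separates_def
    proof (intro ballI impI)
      fix e assume e: "e \<in> arcs G" "tail G e \<noteq> v" "head G e \<noteq> v"
      then have "tail G e \<rightarrow>\<^bsub>del_vert v\<^esub> head G e"
        by (auto simp: arcs_ends_conv del_vert_simps image_iff)
      then have "K.scc_of (tail G e) = K.scc_of (head G e)"
        by (intro K.scc_of_eq K.scc_ofI_reachable) auto
      then show "tail G e \<in> ?A \<longleftrightarrow> head G e \<in> ?A"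
        using e K.in_scc_of_self[of "tail G e"] K.in_scc_of_self[of "head G e"]
          K.scc_of_eq[of _ x]
        by (metis Diff_iff tail_in_verts head_in_verts singletonD verts_del_vert)
    qed
    ultimately show "v \<in> verts G \<and> (\<exists>A. separates G v A \<and> (verts G - {v}) \<inter> A \<noteq> {} \<and> verts G - {v} - A \<noteq> {})"
      using v x y by blast
  next
    assume "v \<in> verts G \<and> (\<exists>A. separates G v A \<and> (verts G - {v}) \<inter> A \<noteq> {} \<and> verts G - {v} - A \<noteq> {})"
    then obtain A x y where sep: "separates G v A" and x: "x \<in> verts G - {v}" "x \<in> A"
      and y: "y \<in> verts G - {v}" "y \<notin> A" by auto
    have "\<not> x \<rightarrow>\<^sup>*\<^bsub>del_vert v\<^esub> y"
    proof
      assume "x \<rightarrow>\<^sup>*\<^bsub>del_vert v\<^esub> y"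
      then have "y \<in> A"
        using sep x(2)
        by (intro K.closed_under_reachability[of A x y]) (auto simp: separates_def del_vert_simps)
      with y show False by simp
    qed
    then have "K.scc_of x \<noteq> K.scc_of y"
      using K.in_scc_of_self[of y] y unfolding K.scc_of_def verts_del_vert by blast
    moreover have "K.scc_of x \<in> K.sccs_verts" "K.scc_of y \<in> K.sccs_verts"
      using x y by (auto intro!: K.scc_of_in_sccs_verts simp: del_vert_simps)
    ultimately have "\<not> card K.sccs_verts \<le> 1"
      using card_le_Suc0_iff_eq[OF K.finite_sccs_verts] by auto
    then show "cut_vertex G v" using v one by (simp add: cut_vertex_def)
  qed
qed (simp add: cut_vertex_def)

text \<open>
  A cut-free connected graph, typically a subgraph of a graph separated at \<open>v\<close>, cannot straddle
  the separation: if it contained \<open>v\<close>, then \<open>v\<close> would be a cut vertex of it, and otherwise it would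
  be disconnected.
\<close>

lemma (in graph) no_cut_vertex_imp_one_side:
  assumes conn: "Digraph_Component.connected G" and cut: "\<forall>x\<in>verts G. \<not> cut_vertex G x"
    and sep: "separates G v A"
  shows "verts G - {v} \<subseteq> A \<or> (verts G - {v}) \<inter> A = {}"
proof (cases "v \<in> verts G")
  case True
  then show ?thesis using cut cut_vertex_iff[OF conn, of v] sep by blast
next
  case False
  then have "head G e \<in> A" if "e \<in> arcs G" "tail G e \<in> A" for e
    using sep that by (metis separates_def tail_in_verts head_in_verts)
  then have "y \<in> A" if "x \<in> verts G" "y \<in> verts G" "x \<in> A" for x y
    using closed_under_reachability[of A x y] that conn by (auto simp: connected_iff)
  then show ?thesis by blast
qed

section \<open>Graph distances\<close>

lemma (in fin_digraph) graph_dist_le: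
  assumes "awalk u p w"
  shows "graph_dist G u w \<le> length p"
proof -
  have "u \<rightarrow>\<^sup>* w" using assms by (rule reachable_awalkI)
  from graph_dist_shortest_path[OF fin_digraph_axioms this] assms
  show ?thesis by auto
qed

lemma (in graph) graph_dist_attained:
  assumes "Digraph_Component.connected G" "u \<in> verts G" "w \<in> verts G"
  obtains p where "awalk u p w" "graph_dist G u w = length p"
proof -
  have "u \<rightarrow>\<^sup>* w" using assms by (simp add: connected_iff)
  from graph_dist_shortest_path[OF fin_digraph_axioms this]
  obtain p where "apath u p w" "graph_dist G u w = length p" by blast
  then show ?thesis using that awalkI_apath by blast
qed

lemma (in graph) graph_dist_pos:
  assumes "Digraph_Component.connected G" "u \<in> verts G" "w \<in> verts G" "u \<noteq> w"
  shows "0 < graph_dist G u w"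
proof -
  obtain p where "awalk u p w" "graph_dist G u w = length p"
    using graph_dist_attained assms by metis
  then show ?thesis using assms(4) by (cases p) (auto simp: awalk_Nil_iff)
qed

lemma (in fin_digraph) graph_dist_self:
  assumes "u \<in> verts G"
  shows "graph_dist G u u = 0"
proof -
  have "u \<rightarrow>\<^sup>* u" using assms by simp
  from graph_dist_shortest_path[OF fin_digraph_axioms this]
  have "0 \<le> graph_dist G u u" by auto
  moreover have "graph_dist G u u \<le> 0"
    using graph_dist_le[of u "[]" u] assms by (simp add: awalk_Nil_iff)
  ultimately show ?thesis by simp
qed

lemma (in graph) awalk_reverse:
  assumes "awalk u p w"
  shows "\<exists>q. awalk w q u \<and> length q = length p"
  using assms
proof (induction p arbitrary: u)
  case Nil
  then show ?case by (auto simp: awalk_Nil_iff)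
next
  case (Cons e p)
  then obtain q where q: "awalk w q (head G e)" "length q = length p"
    and e: "e \<in> arcs G" "u = tail G e"
    by (auto simp: awalk_Cons_iff)
  obtain e' where "e' \<in> arcs G" "tail G e' = head G e" "head G e' = u"
    using e sym_arcs by (auto simp: symmetric_conv)
  then have "awalk (head G e) [e'] u" using arc_implies_awalk by metis
  with q show ?case by (intro exI[of _ "q @ [e']"]) auto
qed

lemma (in graph) graph_dist_commute:
  assumes "Digraph_Component.connected G" "u \<in> verts G" "w \<in> verts G"
  shows "graph_dist G u w = graph_dist G w u"
proof -
  have "graph_dist G x y \<le> graph_dist G y x" if xy: "x \<in> verts G" "y \<in> verts G" for x y
  proof -
    obtain p where "awalk y p x" "graph_dist G y x = length p"
      using graph_dist_attained[OF assms(1) xy(2,1)] .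
    then show ?thesis using awalk_reverse graph_dist_le by metis
  qed
  then show ?thesis using assms by (simp add: order.antisym)
qed

section \<open>Distances across a cut vertex\<close>

text \<open>
  For a separation at \<open>v\<close> this is the retraction of the graph onto the side away from \<open>A\<close>; with
  \<open>- A\<close> in place of \<open>A\<close> it is the retraction onto the other side \<open>insert v A\<close>.
\<close>

definition collapse :: "'a \<Rightarrow> 'a set \<Rightarrow> 'a \<Rightarrow> 'a" where
  "collapse v A x = (if x \<in> A then v else x)"

text \<open>
  Each of the two retractions maps a walk to a walk, apart from arcs that shrink to the point \<open>v\<close>.
  Since every arc survives in exactly one of the two images, the lengths add up. This single
  statement gives both the connectedness of the sides and the lower bound on distances.
\<close>

lemma (in graph) awalk_split:
  assumes v: "v \<in> verts G" and A: "A \<subseteq> verts G - {v}" and sep: "separates G v A"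
    and "awalk x p y"
  shows "\<exists>p1 p2. pre_digraph.awalk (G \<restriction> insert v A) (collapse v (- A) x) p1 (collapse v (- A) y) \<and>
    pre_digraph.awalk (G \<restriction> (verts G - A)) (collapse v A x) p2 (collapse v A y) \<and>
    length p1 + length p2 = length p"
  using assms(4)
proof (induction p arbitrary: x)
  case Nil
  then have "x = y" "x \<in> verts G" by (auto simp: awalk_Nil_iff)
  then show ?case
    using v A by (intro exI[of _ "[]"]) (auto simp: collapse_def pre_digraph.awalk_def pre_digraph.cas.simps)
next
  case (Cons e p)
  let ?H1 = "G \<restriction> insert v A" and ?H2 = "G \<restriction> (verts G - A)"
  interpret H1: wf_digraph ?H1 by (rule wellformed_induce_subgraph)
  interpret H2: wf_digraph ?H2 by (rule wellformed_induce_subgraph)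
  let ?f1 = "collapse v (- A)" and ?f2 = "collapse v A"
  from Cons.prems have e: "e \<in> arcs G" "x = tail G e" and "awalk (head G e) p y"
    by (auto simp: awalk_Cons_iff)
  then obtain p1 p2 where p: "H1.awalk (?f1 (head G e)) p1 (?f1 y)"
      "H2.awalk (?f2 (head G e)) p2 (?f2 y)" "length p1 + length p2 = length p"
    using Cons.IH by blast
  \<comment> \<open>the first arc lies in exactly one side; in the other side both its ends become \<open>v\<close>\<close>
  show ?case
  proof (cases "tail G e \<in> A \<or> head G e \<in> A")
    case True
    then have "e \<in> arcs ?H1" "?f1 (tail G e) = tail G e" "?f1 (head G e) = head G e"
        "?f2 (tail G e) = v" "?f2 (head G e) = v"
      using e A sep by (auto simp: collapse_def separates_def)
    then show ?thesis using p e
      by (intro exI[of _ "e # p1"] exI[of _ p2]) (auto simp: H1.awalk_Cons_iff)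
  next
    case False
    then have "e \<in> arcs ?H2" "?f2 (tail G e) = tail G e" "?f2 (head G e) = head G e"
        "?f1 (tail G e) = v" "?f1 (head G e) = v"
      using e A by (auto simp: collapse_def)
    then show ?thesis using p e
      by (intro exI[of _ p1] exI[of _ "e # p2"]) (auto simp: H2.awalk_Cons_iff)
  qed
qed

lemma (in graph) separation_connected:
  assumes conn: "Digraph_Component.connected G"
    and v: "v \<in> verts G" and A: "A \<subseteq> verts G - {v}" and sep: "separates G v A"
  shows "Digraph_Component.connected (G \<restriction> insert v A)"
    and "Digraph_Component.connected (G \<restriction> (verts G - A))"
proof -
  let ?H1 = "G \<restriction> insert v A" and ?H2 = "G \<restriction> (verts G - A)"
  interpret H1: graph ?H1 using v A by (intro graph_induce_subgraph) auto
  interpret H2: graph ?H2 by (rule graph_induce_subgraph) auto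
  have split: "\<exists>p1 p2. H1.awalk (collapse v (- A) x) p1 (collapse v (- A) y) \<and>
      H2.awalk (collapse v A x) p2 (collapse v A y)"
    if "x \<in> verts G" "y \<in> verts G" for x y
    using awalk_split[OF v A sep] conn that unfolding connected_iff reachable_awalk by meson
  have "x \<rightarrow>\<^sup>*\<^bsub>?H1\<^esub> y" if "x \<in> insert v A" "y \<in> insert v A" for x y
  proof -
    have "x \<in> verts G" "y \<in> verts G" "collapse v (- A) x = x" "collapse v (- A) y = y"
      using that v A by (auto simp: collapse_def)
    then show ?thesis using split[of x y] by (auto simp: H1.reachable_awalk)
  qed
  then show "Digraph_Component.connected ?H1" by (simp add: H1.connected_iff)
  have "x \<rightarrow>\<^sup>*\<^bsub>?H2\<^esub> y" if "x \<in> verts G - A" "y \<in> verts G - A" for x y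
  proof -
    have "x \<in> verts G" "y \<in> verts G" "collapse v A x = x" "collapse v A y = y"
      using that by (auto simp: collapse_def)
    then show ?thesis using split[of x y] by (auto simp: H2.reachable_awalk)
  qed
  then show "Digraph_Component.connected ?H2" using v A by (auto simp: H2.connected_iff)
qed

text \<open>
  The graph metric is the sum of two pulled-back metrics, as if the graph sat isometrically in the
  \<open>\<ell>\<^sub>1\<close>-product of its two sides. One inequality splits a shortest walk with \<open>awalk_split\<close>. For the
  other one, shortest walks in the two sides are concatenated at \<open>v\<close>; when \<open>x\<close> and \<open>y\<close> lie
  on the same side, the walk within that side is enough.
\<close>

lemma (in graph) graph_dist_separation:
  assumes conn: "Digraph_Component.connected G"
    and v: "v \<in> verts G" and A: "A \<subseteq> verts G - {v}" and sep: "separates G v A"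
    and x: "x \<in> verts G" and y: "y \<in> verts G"
  shows "graph_dist G x y =
    graph_dist (G \<restriction> insert v A) (collapse v (- A) x) (collapse v (- A) y) +
    graph_dist (G \<restriction> (verts G - A)) (collapse v A x) (collapse v A y)"
proof (rule order.antisym)
  let ?H1 = "G \<restriction> insert v A" and ?H2 = "G \<restriction> (verts G - A)"
  let ?f1 = "collapse v (- A)" and ?f2 = "collapse v A"
  interpret H1: graph ?H1 using v A by (intro graph_induce_subgraph) auto
  interpret H2: graph ?H2 by (rule graph_induce_subgraph) auto
  note conns = separation_connected[OF conn v A sep]
  have f: "?f1 x \<in> verts ?H1" "?f1 y \<in> verts ?H1" "?f2 x \<in> verts ?H2" "?f2 y \<in> verts ?H2"
    using v A x y by (auto simp: collapse_def)
  show "graph_dist ?H1 (?f1 x) (?f1 y) + graph_dist ?H2 (?f2 x) (?f2 y) \<le> graph_dist G x y"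
  proof -
    obtain p where p: "awalk x p y" "graph_dist G x y = length p"
      using graph_dist_attained[OF conn x y] .
    from awalk_split[OF v A sep p(1)] obtain p1 p2
      where "H1.awalk (?f1 x) p1 (?f1 y)" "H2.awalk (?f2 x) p2 (?f2 y)"
        and "length p1 + length p2 = length p" by auto
    then show ?thesis using H1.graph_dist_le H2.graph_dist_le p(2) by force
  qed
  show "graph_dist G x y \<le> graph_dist ?H1 (?f1 x) (?f1 y) + graph_dist ?H2 (?f2 x) (?f2 y)"
  proof -
    obtain p1 where p1: "H1.awalk (?f1 x) p1 (?f1 y)" "graph_dist ?H1 (?f1 x) (?f1 y) = length p1"
      using H1.graph_dist_attained[OF conns(1) f(1,2)] .
    obtain p2 where p2: "H2.awalk (?f2 x) p2 (?f2 y)" "graph_dist ?H2 (?f2 x) (?f2 y) = length p2"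
      using H2.graph_dist_attained[OF conns(2) f(3,4)] .
    have w1: "awalk (?f1 x) p1 (?f1 y)"
      using p1(1) v A by (intro subgraph_awalk_imp_awalk[of ?H1]) (auto intro!: induced_imp_subgraph)
    have w2: "awalk (?f2 x) p2 (?f2 y)"
      using p2(1) by (intro subgraph_awalk_imp_awalk[of ?H2]) (auto intro!: induced_imp_subgraph)
    consider "x \<in> A" "y \<in> A" | "x \<in> A" "y \<notin> A" | "x \<notin> A" "y \<in> A" | "x \<notin> A" "y \<notin> A" by blast
    then have "\<exists>q. awalk x q y \<and> length q \<le> length p1 + length p2"
    proof cases
      case 1
      then show ?thesis using w1 by (auto simp: collapse_def intro!: exI[of _ p1])
    next
      case 2
      then show ?thesis using w1 w2
        by (intro exI[of _ "p1 @ p2"]) (auto simp: collapse_def)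
    next
      case 3
      then show ?thesis using w1 w2
        by (intro exI[of _ "p2 @ p1"]) (auto simp: collapse_def)
    next
      case 4
      then show ?thesis using w2 by (auto simp: collapse_def intro!: exI[of _ p2])
    qed
    then show ?thesis using graph_dist_le p1(2) p2(2) by force
  qed
qed

section \<open>Negative type\<close>

lemma negative_type_add:
  assumes "negative_type X d1" "negative_type X d2"
    and "\<And>x y. x \<in> X \<Longrightarrow> y \<in> X \<Longrightarrow> d x y = d1 x y + d2 x y"
  shows "negative_type X d"
  unfolding negative_type_def
proof (intro allI impI)
  fix w :: "_ \<Rightarrow> int"
  assume w: "(\<Sum>x\<in>X. w x) = 0"
  have "(\<Sum>x\<in>X. \<Sum>y\<in>X. of_int (w x) * of_int (w y) * d x y) =
      (\<Sum>x\<in>X. \<Sum>y\<in>X. of_int (w x) * of_int (w y) * d1 x y) +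
      (\<Sum>x\<in>X. \<Sum>y\<in>X. of_int (w x) * of_int (w y) * d2 x y)"
    by (simp add: assms(3) algebra_simps sum.distrib cong: sum.cong)
  also have "\<dots> \<le> 0"
    using assms(1,2) w by (intro add_nonpos_nonpos) (auto simp: negative_type_def)
  finally show "(\<Sum>x\<in>X. \<Sum>y\<in>X. of_int (w x) * of_int (w y) * d x y) \<le> 0" .
qed

text \<open>
  The quadratic form of the pulled-back distance at weights \<open>w\<close> is the form of \<open>d\<close> at the weights
  pushed forward along \<open>f\<close>, and pushing forward preserves the total weight and integrality.
  This is where several vertices pool their weights at a cut vertex.
\<close>

lemma negative_type_pullback:
  assumes fin: "finite X" "finite Y" and f: "f ` X \<subseteq> Y" and neg: "negative_type Y d"
  shows "negative_type X (\<lambda>x y. d (f x) (f y))"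
  unfolding negative_type_def
proof (intro allI impI)
  fix w :: "_ \<Rightarrow> int"
  assume w: "(\<Sum>x\<in>X. w x) = 0"
  define w' where "w' a = (\<Sum>x\<in>{x\<in>X. f x = a}. w x)" for a
  have push: "(\<Sum>x\<in>X. of_int (w x) * g (f x)) = (\<Sum>a\<in>Y. of_int (w' a) * g a)" for g :: "_ \<Rightarrow> real"
  proof -
    have "(\<Sum>x\<in>X. of_int (w x) * g (f x)) = (\<Sum>a\<in>Y. \<Sum>x\<in>{x\<in>X. f x = a}. real_of_int (w x) * g (f x))"
      by (rule sum.group[symmetric, OF fin f])
    also have "\<dots> = (\<Sum>a\<in>Y. of_int (w' a) * g a)"
      by (auto simp: w'_def sum_distrib_right intro!: sum.cong)
    finally show ?thesis .
  qed
  have "(\<Sum>x\<in>X. \<Sum>y\<in>X. of_int (w x) * of_int (w y) * d (f x) (f y)) =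
      (\<Sum>x\<in>X. of_int (w x) * (\<Sum>y\<in>X. of_int (w y) * d (f x) (f y)))"
    by (simp add: sum_distrib_left mult.assoc)
  also have "\<dots> = (\<Sum>a\<in>Y. of_int (w' a) * (\<Sum>b\<in>Y. of_int (w' b) * d a b))"
    by (simp only: push push[of "\<lambda>a. \<Sum>b\<in>Y. of_int (w' b) * d a b"])
  also have "\<dots> = (\<Sum>a\<in>Y. \<Sum>b\<in>Y. of_int (w' a) * of_int (w' b) * d a b)"
    by (simp add: sum_distrib_left mult.assoc)
  also have "\<dots> \<le> 0"
  proof -
    have "(\<Sum>a\<in>Y. w' a) = 0" unfolding w'_def using sum.group[OF fin f, of w] w by simp
    then show ?thesis using neg by (simp add: negative_type_def)
  qed
  finally show "(\<Sum>x\<in>X. \<Sum>y\<in>X. of_int (w x) * of_int (w y) * d (f x) (f y)) \<le> 0" .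
qed

text \<open>
  Integer weights suffice by scaling and continuity: \<open>m w\<close> is rounded down at all points but
  one, that last point absorbs the error to keep the total zero, and \<open>m \<rightarrow> \<infinity>\<close> after division by \<open>m\<close>.
\<close>

lemma negative_type_real_weights:
  fixes w :: "'a \<Rightarrow> real"
  assumes fin: "finite X" and neg: "negative_type X d" and w: "(\<Sum>x\<in>X. w x) = 0"
  shows "(\<Sum>x\<in>X. \<Sum>y\<in>X. w x * w y * d x y) \<le> 0"
proof (cases "X = {}")
  case False
  then obtain z where z: "z \<in> X" by blast
  define r :: "nat \<Rightarrow> 'a \<Rightarrow> int" where
    "r m x = (if x = z then - (\<Sum>y\<in>X - {z}. \<lfloor>m * w y\<rfloor>) else \<lfloor>m * w x\<rfloor>)" for m x
  have r_sum: "(\<Sum>x\<in>X. r m x) = 0" for m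
  proof -
    have "(\<Sum>x\<in>X - {z}. r m x) = (\<Sum>y\<in>X - {z}. \<lfloor>m * w y\<rfloor>)"
      by (rule sum.cong) (auto simp: r_def)
    then show ?thesis using sum.remove[OF fin z, of "r m"] by (simp add: r_def)
  qed
  have floor_lim: "(\<lambda>m. of_int \<lfloor>m * c\<rfloor> / m) \<longlonglongrightarrow> c" for c :: real
  proof (rule real_tendsto_sandwich)
    show "\<forall>\<^sub>F m in sequentially. c - 1 / real m \<le> of_int \<lfloor>m * c\<rfloor> / m"
      using eventually_gt_at_top[of 0]
    proof eventually_elim
      case (elim m)
      have "m * c - 1 \<le> of_int \<lfloor>m * c\<rfloor>" by linarith
      then have "(m * c - 1) / m \<le> of_int \<lfloor>m * c\<rfloor> / m" by (rule divide_right_mono) simp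
      then show ?case using elim by (simp add: diff_divide_distrib)
    qed
    show "\<forall>\<^sub>F m in sequentially. of_int \<lfloor>m * c\<rfloor> / m \<le> c"
      using eventually_gt_at_top[of 0]
    proof eventually_elim
      case (elim m)
      have "of_int \<lfloor>m * c\<rfloor> \<le> m * c" by linarith
      then have "of_int \<lfloor>m * c\<rfloor> / m \<le> m * c / m" by (rule divide_right_mono) simp
      then show ?case using elim by simp
    qed
    show "(\<lambda>m. c - 1 / real m) \<longlonglongrightarrow> c" using tendsto_diff[OF tendsto_const[of c] lim_1_over_n] by simp
  qed simp
  have r_lim: "(\<lambda>m. of_int (r m x) / m) \<longlonglongrightarrow> w x" if x: "x \<in> X" for x
  proof (cases "x = z")
    case True
    have "(\<lambda>m. - (\<Sum>y\<in>X - {z}. of_int \<lfloor>m * w y\<rfloor> / m)) \<longlonglongrightarrow> - (\<Sum>y\<in>X - {z}. w y)"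
      by (intro tendsto_intros floor_lim)
    moreover have "- (\<Sum>y\<in>X - {z}. w y) = w z"
      using w z fin by (simp add: sum.remove[of X z])
    ultimately show ?thesis using True by (simp add: r_def sum_divide_distrib)
  next
    case False
    then show ?thesis using floor_lim by (simp add: r_def)
  qed
  let ?F = "\<lambda>u. \<Sum>x\<in>X. \<Sum>y\<in>X. u x * u y * d x y"
  have "?F (\<lambda>x. of_int (r m x) / m) \<le> 0" for m
  proof -
    have "?F (\<lambda>x. of_int (r m x) / m) = ?F (\<lambda>x. of_int (r m x)) / m\<^sup>2"
      by (simp add: sum_divide_distrib power2_eq_square)
    moreover have "?F (\<lambda>x. of_int (r m x)) \<le> 0"
      using neg r_sum by (simp add: negative_type_def)
    ultimately show ?thesis by (simp add: divide_nonpos_nonneg)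
  qed
  moreover have "(\<lambda>m. ?F (\<lambda>x. of_int (r m x) / m)) \<longlonglongrightarrow> ?F w"
    by (intro tendsto_intros r_lim)
  ultimately show ?thesis by (intro LIMSEQ_le_const2) auto
qed simp

section \<open>From blocks to the whole graph\<close>

lemma (in wf_digraph) subgraph_induceI:
  assumes "subgraph H G" "verts H \<subseteq> S"
  shows "subgraph H (G \<restriction> S)"
proof -
  have "arcs H \<subseteq> {e \<in> arcs G. tail G e \<in> S \<and> head G e \<in> S}"
  proof
    fix e assume e: "e \<in> arcs H"
    interpret H: wf_digraph H using assms(1) by auto
    have "tail H = tail G" "head H = head G" using assms(1) by (auto simp: subgraph_def compatible_def)
    then show "e \<in> {e \<in> arcs G. tail G e \<in> S \<and> head G e \<in> S}"
      using e assms H.tail_in_verts[OF e] H.head_in_verts[OF e] by (auto simp: subgraph_def)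
  qed
  then show ?thesis using assms wellformed_induce_subgraph
    by (auto simp: subgraph_def compatible_def)
qed

lemma separates_subgraph:
  assumes "separates G v A" "subgraph H G"
  shows "separates H v A"
  using assms by (auto simp: separates_def subgraph_def compatible_def)

definition cut_free :: "('a, 'b) pre_digraph \<Rightarrow> bool" where
  "cut_free H \<longleftrightarrow> graph H \<and> Digraph_Component.connected H \<and> (\<forall>v\<in>verts H. \<not> cut_vertex H v)"

text \<open>
  The sets to which the induction below applies. Quantifying over all cut-free subgraphs of the
  fixed graph \<open>G\<close>, and not over the blocks of the part induced by \<open>S\<close>, avoids comparing the
  blocks of \<open>G\<close> with those of its parts.
\<close>

definition block_closed :: "('a, 'b) pre_digraph \<Rightarrow> 'a set \<Rightarrow> bool" where
  "block_closed G S \<longleftrightarrow>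
    (\<forall>H. subgraph H G \<and> cut_free H \<and> 2 \<le> card (verts H \<inter> S) \<longrightarrow> verts H \<subseteq> S)"

lemma two_le_card_obtain:
  assumes "2 \<le> card X"
  obtains x where "x \<in> X" "x \<noteq> v"
proof -
  have "\<not> X \<subseteq> {v}"
  proof
    assume "X \<subseteq> {v}"
    then have "card X \<le> card {v}" by (intro card_mono) auto
    with assms show False by simp
  qed
  then show thesis using that by blast
qed

lemma (in graph) block_closed_separation:
  assumes S: "S \<subseteq> verts G" and closed: "block_closed G S"
    and v: "v \<in> S" and A: "A \<subseteq> S - {v}" and sep: "separates (G \<restriction> S) v A"
  shows "block_closed G (insert v A)" and "block_closed G (S - A)"
proof -
  have side: "verts H \<subseteq> S \<and> (verts H - {v} \<subseteq> A \<or> (verts H - {v}) \<inter> A = {})"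
    if H: "subgraph H G" "cut_free H" and T: "2 \<le> card (verts H \<inter> T)" "T \<subseteq> S" for H T
  proof -
    interpret H: graph H using H(2) by (simp add: cut_free_def)
    have "card (verts H \<inter> T) \<le> card (verts H \<inter> S)"
      using T(2) by (intro card_mono) auto
    with T(1) closed H have HS: "verts H \<subseteq> S" by (auto simp: block_closed_def)
    have "separates H v A"
      using separates_subgraph[OF sep subgraph_induceI[OF H(1) HS]] .
    with HS show ?thesis
      using H.no_cut_vertex_imp_one_side H(2) by (simp add: cut_free_def)
  qed
  show "block_closed G (insert v A)"
    unfolding block_closed_def
  proof (intro allI impI, elim conjE)
    fix H assume H: "subgraph H G" "cut_free H" and two: "2 \<le> card (verts H \<inter> insert v A)"
    from two obtain x where "x \<in> verts H \<inter> insert v A" "x \<noteq> v" by (rule two_le_card_obtain)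
    with side[OF H two] v A show "verts H \<subseteq> insert v A" by blast
  qed
  show "block_closed G (S - A)"
    unfolding block_closed_def
  proof (intro allI impI, elim conjE)
    fix H assume H: "subgraph H G" "cut_free H" and two: "2 \<le> card (verts H \<inter> (S - A))"
    from two obtain x where "x \<in> verts H \<inter> (S - A)" "x \<noteq> v" by (rule two_le_card_obtain)
    with side[OF H two] v A show "verts H \<subseteq> S - A" by blast
  qed
qed

lemma (in graph) block_closed_cut_free_imp_block:
  assumes S: "S \<subseteq> verts G" "2 \<le> card S" and closed: "block_closed G S" and "cut_free (G \<restriction> S)"
  shows "block G (G \<restriction> S)"
  unfolding block_def cut_free_def[symmetric]
proof (rule max_subgraphI)
  show "cut_free (G \<restriction> S)" by fact
  show "subgraph (G \<restriction> S) G" using S by (auto intro!: induced_imp_subgraph)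
  fix H assume ne: "G \<restriction> S \<noteq> H" and sub: "subgraph (G \<restriction> S) H" "subgraph H G"
  show "\<not> cut_free H"
  proof
    assume H: "cut_free H"
    have SH: "S \<subseteq> verts H" using sub(1) by (auto simp: subgraph_def)
    then have "verts H \<inter> S = S" by blast
    with closed H sub(2) S(2) have HS: "verts H \<subseteq> S" by (simp add: block_closed_def)
    then have "subgraph H (G \<restriction> S)" using subgraph_induceI sub(2) by blast
    with sub(1) have "G \<restriction> S = H"
      by (intro pre_digraph.equality) (auto simp: subgraph_def compatible_def)
    with ne show False by simp
  qed
qed

text \<open>
  Induction on the size of \<open>S\<close>. If the subgraph induced by \<open>S\<close> has no cut vertex, it is a block of
  \<open>G\<close> or a single vertex. Otherwise a cut vertex separates it into two smaller block-closed
  parts, and its metric is the sum of the metrics of the parts pulled back along the retractions.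
\<close>

lemma (in graph) negative_type_block_closed:
  assumes blocks: "\<And>B. block G B \<Longrightarrow> negative_type (verts B) (graph_dist B)"
    and "S \<subseteq> verts G" "Digraph_Component.connected (G \<restriction> S)" "block_closed G S"
  shows "negative_type S (graph_dist (G \<restriction> S))"
  using assms(2-)
proof (induction "card S" arbitrary: S rule: less_induct)
  case less
  interpret S: graph "G \<restriction> S" using less.prems(1) by (rule graph_induce_subgraph)
  have fin: "finite S" using S.finite_verts by simp
  show ?case
  proof (cases "2 \<le> card S")
    case False
    have "S \<noteq> {}" using less.prems(2) by (simp add: S.connected_iff)
    with fin have "card S \<noteq> 0" by simp
    with False have "card S = 1" by linarith
    then obtain x where "S = {x}" by (auto simp: card_1_singleton_iff)
    then show ?thesis by (auto simp: negative_type_def)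
  next
    case two: True
    show ?thesis
    proof (cases "cut_free (G \<restriction> S)")
      case True
      then have "block G (G \<restriction> S)"
        using block_closed_cut_free_imp_block less.prems two by blast
      from blocks[OF this] show ?thesis by simp
    next
      case False
      then obtain v where v: "v \<in> S" and "cut_vertex (G \<restriction> S) v"
        using S.graph_axioms less.prems(2) by (auto simp: cut_free_def)
      then obtain A' where sep': "separates (G \<restriction> S) v A'"
        and ne: "(S - {v}) \<inter> A' \<noteq> {}" "S - {v} - A' \<noteq> {}"
        using S.cut_vertex_iff[OF less.prems(2)] by auto
      \<comment> \<open>\<open>A'\<close> may contain vertices outside \<open>S - {v}\<close>\<close>
      define A where "A = (S - {v}) \<inter> A'"
      have A: "A \<subseteq> S - {v}" by (auto simp: A_def)
      have sep: "separates (G \<restriction> S) v A"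
        using sep' by (auto simp: separates_def A_def)
      have closed: "block_closed G (insert v A)" "block_closed G (S - A)"
        using block_closed_separation[OF less.prems(1,3) v A sep] .
      have induce: "(G \<restriction> S) \<restriction> T = G \<restriction> T" if "T \<subseteq> S" for T
        using that by (intro pre_digraph.equality) auto
      have sub: "insert v A \<subseteq> S" "S - A \<subseteq> S" using v A by auto
      have vA: "v \<in> verts (G \<restriction> S)" "A \<subseteq> verts (G \<restriction> S) - {v}" using v A by auto
      note conn = S.separation_connected[OF less.prems(2) vA sep, simplified, unfolded induce[OF sub(1)] induce[OF sub(2)]]
      have "insert v A \<subset> S" "S - A \<subset> S" using ne v by (auto simp: A_def)
      then have "card (insert v A) < card S" "card (S - A) < card S"
        using fin by (auto intro: psubset_card_mono)
      with less.hyps closed conn sub less.prems(1)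
      have neg: "negative_type (insert v A) (graph_dist (G \<restriction> insert v A))"
        "negative_type (S - A) (graph_dist (G \<restriction> (S - A)))"
        by (meson order.trans)+
      let ?f1 = "collapse v (- A)" and ?f2 = "collapse v A"
      have "negative_type S (\<lambda>x y. graph_dist (G \<restriction> insert v A) (?f1 x) (?f1 y))"
        using fin A v by (intro negative_type_pullback[OF _ _ _ neg(1)])
          (auto simp: collapse_def intro: finite_subset)
      moreover have "negative_type S (\<lambda>x y. graph_dist (G \<restriction> (S - A)) (?f2 x) (?f2 y))"
        using fin A v by (intro negative_type_pullback[OF _ _ _ neg(2)])
          (auto simp: collapse_def)
      ultimately show ?thesis
      proof (rule negative_type_add)
        fix x y assume "x \<in> S" "y \<in> S"
        then show "graph_dist (G \<restriction> S) x y = graph_dist (G \<restriction> insert v A) (?f1 x) (?f1 y) +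
            graph_dist (G \<restriction> (S - A)) (?f2 x) (?f2 y)"
          using S.graph_dist_separation[OF less.prems(2) vA sep, of x y]
          by (simp add: induce[OF sub(1)] induce[OF sub(2)])
      qed
    qed
  qed
qed

lemma (in graph) negative_type_of_blocks:
  assumes "Digraph_Component.connected G"
    and "\<And>B. block G B \<Longrightarrow> negative_type (verts B) (graph_dist B)"
  shows "negative_type (verts G) (graph_dist G)"
proof -
  have "G \<restriction> verts G = G" by (intro pre_digraph.equality) auto
  moreover have "block_closed G (verts G)" by (auto simp: block_closed_def subgraph_def)
  ultimately show ?thesis
    using negative_type_block_closed[OF assms(2), of "verts G"] assms(1) by simp
qed

section \<open>Symmetric real matrices\<close>

lemma scalar_prod_symmetric_mat:
  assumes A: "A \<in> carrier_mat n n" and sym: "transpose_mat A = A"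
    and x: "x \<in> carrier_vec n" and y: "y \<in> carrier_vec n"
  shows "(A *\<^sub>v x) \<bullet> y = x \<bullet> (A *\<^sub>v (y :: 'a :: comm_ring_1 vec))"
  using transpose_vec_mult_scalar[OF A y x] unfolding sym .

text \<open>
  For an eigenvector \<open>x\<close>, the conjugate of \<open>x\<close> is an eigenvector for the conjugate of \<open>k\<close>, because \<open>A\<close> is real.
  Symmetry of \<open>A\<close> then equates \<open>k \<bar>x\<bar>\<^sup>2\<close> with its conjugate.
\<close>

lemma eigenvalue_symmetric_real:
  fixes A :: "real mat"
  assumes A: "A \<in> carrier_mat n n" and sym: "transpose_mat A = A"
    and ev: "eigenvalue (map_mat complex_of_real A) k"
  shows "k \<in> \<real>"
proof -
  let ?C = "map_mat complex_of_real A"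
  have C: "?C \<in> carrier_mat n n" using A by simp
  have symC: "transpose_mat ?C = ?C" using arg_cong[OF sym, of "map_mat complex_of_real"] by (simp add: map_mat_transpose)
  obtain x where x: "x \<in> carrier_vec n" "x \<noteq> 0\<^sub>v n" "?C *\<^sub>v x = k \<cdot>\<^sub>v x"
    using ev A by (auto simp: eigenvalue_def eigenvector_def)
  have cx: "conjugate x \<in> carrier_vec n" using x by simp
  have "?C *\<^sub>v conjugate x = conjugate (?C *\<^sub>v x)"
    using A x(1) by (intro eq_vecI) (auto simp: scalar_prod_def)
  also have "\<dots> = cnj k \<cdot>\<^sub>v conjugate x"
    by (simp add: x(3) conjugate_smult_vec)
  finally have "k * (x \<bullet>c x) = cnj k * (x \<bullet>c x)"
    using scalar_prod_symmetric_mat[OF C symC x(1) cx] x cx by simp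
  moreover have "x \<bullet>c x \<noteq> 0" using conjugate_square_eq_0_vec[OF x(1)] x(2) by simp
  ultimately show ?thesis by (simp add: Reals_cnj_iff)
qed

lemma char_poly_symmetric_real_splits:
  fixes A :: "real mat"
  assumes A: "A \<in> carrier_mat n n" and sym: "transpose_mat A = A"
  obtains es where "char_poly A = (\<Prod>e\<leftarrow>es. [:- e, 1:])"
proof -
  let ?C = "map_mat complex_of_real A"
  have C: "?C \<in> carrier_mat n n" using A by simp
  obtain as where as: "char_poly ?C = (\<Prod>a\<leftarrow>as. [:- a, 1:])"
    using char_poly_factorized[OF C] by blast
  have "a \<in> \<real>" if "a \<in> set as" for a
  proof -
    have "poly (char_poly ?C) a = 0"
      unfolding as using that by (auto simp: poly_prod_list prod_list_zero_iff)
    then show ?thesis using eigenvalue_symmetric_real[OF A sym] eigenvalue_root_char_poly[OF C] by blast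
  qed
  then have re: "map complex_of_real (map Re as) = as"
    unfolding list.map_comp by (intro map_idI) simp
  \<comment> \<open>the complex roots are real, so the factorization over the complex numbers descends\<close>
  interpret map_poly_comm_ring_hom complex_of_real ..
  have hom: "map_poly complex_of_real (\<Prod>e\<leftarrow>es. [:- e, 1:]) = (\<Prod>e\<leftarrow>map complex_of_real es. [:- e, 1:])" for es
    by (induction es) (simp_all add: hom_mult of_real_hom.map_poly_pCons_hom o_def del: mult_pCons_left)
  have "map_poly complex_of_real (\<Prod>e\<leftarrow>map Re as. [:- e, 1:]) = map_poly complex_of_real (char_poly A)"
    unfolding hom re of_real_hom.char_poly_hom[OF A, symmetric] as ..
  then have "char_poly A = (\<Prod>e\<leftarrow>map Re as. [:- e, 1:])"
    by (simp add: poly_eq_iff coeff_map_poly)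
  then show thesis by (rule that)
qed

lemma order_prod_linear_factors:
  "Polynomial.order k (\<Prod>e\<leftarrow>es. [:- e, 1:]) = count_list es (k :: 'a :: idom)"
proof (induction es)
  case (Cons e es)
  have "(\<Prod>e\<leftarrow>es. [:- e, 1:]) \<noteq> (0 :: 'a poly)" by (auto simp: prod_list_zero_iff)
  then have "Polynomial.order k ([:- e, 1:] * (\<Prod>e\<leftarrow>es. [:- e, 1:])) =
      Polynomial.order k [:- e, 1:] + Polynomial.order k (\<Prod>e\<leftarrow>es. [:- e, 1:])"
    by (intro order_mult) (simp del: mult_pCons_left)
  moreover have "Polynomial.order k [:- e, 1:] = (if e = k then 1 else 0)"
    using order_power_n_n[of e 1] by (auto intro: order_0I)
  ultimately show ?case using Cons.IH by simp
qed simp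

lemma num_pos_eigenvalues_eq_length:
  assumes A: "A \<in> carrier_mat n n" and es: "char_poly A = (\<Prod>e\<leftarrow>es. [:- e, 1:])"
  shows "num_pos_eigenvalues A = length (filter (\<lambda>e. 0 < e) es)"
proof -
  have "eigenvalue A k \<longleftrightarrow> k \<in> set es" for k
    unfolding eigenvalue_root_char_poly[OF A] es
    by (auto simp: poly_prod_list prod_list_zero_iff image_iff)
  then have "num_pos_eigenvalues A = (\<Sum>k\<in>set (filter (\<lambda>e. 0 < e) es). count_list es k)"
    by (simp add: num_pos_eigenvalues_def es order_prod_linear_factors)
  also have "\<dots> = (\<Sum>k\<in>set (filter (\<lambda>e. 0 < e) es). count_list (filter (\<lambda>e. 0 < e) es) k)"
  proof (rule sum.cong[OF refl])
    fix k assume "k \<in> set (filter (\<lambda>e. 0 < e) es)"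
    then have "0 < k" by simp
    then show "count_list es k = count_list (filter (\<lambda>e. 0 < e) es) k"
      by (induction es) auto
  qed
  also have "\<dots> = length (filter (\<lambda>e. 0 < e) es)" by (rule sum_count_set) auto
  finally show ?thesis .
qed

lemma schur_decomposition_obtain:
  fixes A :: "real mat"
  assumes A: "A \<in> carrier_mat n n" and es: "char_poly A = (\<Prod>e\<leftarrow>es. [:- e, 1:])"
  obtains B P Q where "A = P * B * Q" "P * Q = 1\<^sub>m n" "Q * P = 1\<^sub>m n"
    "B \<in> carrier_mat n n" "P \<in> carrier_mat n n" "Q \<in> carrier_mat n n"
    "upper_triangular B" "diag_mat B = es"
proof -
  obtain B P Q where "schur_decomposition A es = (B, P, Q)" by (metis prod_cases3)
  from schur_decomposition[OF A es this] have sim: "similar_mat_wit A B P Q"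
    and B: "upper_triangular B" "diag_mat B = es" by auto
  from similar_mat_witD2[OF A sim] B that show thesis by auto
qed

text \<open>
  This contains the comparison of algebraic with geometric multiplicity that is needed, without a
  full diagonalization. In a Schur triangularization whose diagonal starts with two positive
  eigenvalues \<open>a\<close> and \<open>b\<close>, the first two basis vectors satisfy \<open>A p1 = a p1\<close> and
  \<open>A p2 = c p1 + b p2\<close>. One Gram-Schmidt step turns \<open>p2\<close> into a vector \<open>q\<close> orthogonal to \<open>p1\<close>, and
  by symmetry of \<open>A\<close> it is an eigenvector for \<open>b\<close>, no matter whether \<open>a = b\<close>.
\<close>

lemma two_positive_eigenvalues:
  fixes A :: "real mat"
  assumes A: "A \<in> carrier_mat n n" and sym: "transpose_mat A = A"
    and two: "2 \<le> num_pos_eigenvalues A"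
  obtains a b p q where "0 < a" "0 < b" "p \<in> carrier_vec n" "q \<in> carrier_vec n"
    "p \<noteq> 0\<^sub>v n" "q \<noteq> 0\<^sub>v n" "p \<bullet> q = 0" "A *\<^sub>v p = a \<cdot>\<^sub>v p" "A *\<^sub>v q = b \<cdot>\<^sub>v q"
proof -
  obtain es where es: "char_poly A = (\<Prod>e\<leftarrow>es. [:- e, 1:])"
    using char_poly_symmetric_real_splits[OF A sym] .
  let ?pos = "filter (\<lambda>e. 0 < e) es"
  have "2 \<le> length ?pos" using two num_pos_eigenvalues_eq_length[OF A es] by simp
  then obtain a b rest where pos: "?pos = a # b # rest"
    by (metis Suc_le_length_iff numeral_2_eq_2)
  have "a \<in> set ?pos" "b \<in> set ?pos" unfolding pos by simp_all
  then have ab: "0 < a" "0 < b" by simp_all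
  \<comment> \<open>the Schur form keeps the given order of the eigenvalues, so two positive ones are put in front\<close>
  let ?es = "a # b # rest @ filter (\<lambda>e. \<not> 0 < e) es"
  have "mset ?es = mset es"
    using arg_cong[OF pos, of mset] mset_filter[of "\<lambda>e. 0 < e" es]
      multiset_partition[of "mset es" "\<lambda>e. 0 < e"]
    by (simp add: mset_filter)
  then have "prod_mset (mset (map (\<lambda>e. [:- e, 1:]) ?es)) = prod_mset (mset (map (\<lambda>e. [:- e, 1:]) es))"
    unfolding mset_map by (rule arg_cong)
  then have "(\<Prod>e\<leftarrow>?es. [:- e, 1:]) = (\<Prod>e\<leftarrow>es. [:- e, 1:])"
    unfolding prod_mset_prod_list .
  with es have "char_poly A = (\<Prod>e\<leftarrow>?es. [:- e, 1:])" by simp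
  then obtain B P Q where BPQ: "A = P * B * Q" "P * Q = 1\<^sub>m n" "Q * P = 1\<^sub>m n"
      and carr: "B \<in> carrier_mat n n" "P \<in> carrier_mat n n" "Q \<in> carrier_mat n n"
      and ut: "upper_triangular B" and dB: "diag_mat B = ?es"
    by (rule schur_decomposition_obtain[OF A])
  have "length (diag_mat B) = n" using carr by (simp add: diag_mat_def)
  then have n: "2 \<le> n" unfolding dB by simp
  have B00: "B $$ (0,0) = a" and B11: "B $$ (1,1) = b" and B10: "B $$ (1,0) = 0"
    using arg_cong[OF dB, of "\<lambda>l. l ! 0"] arg_cong[OF dB, of "\<lambda>l. l ! 1"] carr n ut
    by (auto simp: diag_mat_def upper_triangular_def)
  define c where "c = B $$ (0,1)"
  define p1 p2 where "p1 = col P 0" and "p2 = col P 1"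
  have p12: "p1 \<in> carrier_vec n" "p2 \<in> carrier_vec n" using carr by (auto simp: p1_def p2_def)
  have AP: "A * P = P * B"
    using BPQ carr by (metis assoc_mult_mat mult_carrier_mat right_mult_one_mat)
  have Acol: "A *\<^sub>v col P j = P *\<^sub>v col B j" if "j < n" for j
    using arg_cong[OF AP, of "\<lambda>M. col M j"] col_mult2[OF A carr(2) that] col_mult2[OF carr(2,1) that]
    by (simp only:)
  have two_terms: "(\<Sum>i<n. f i) = f 0 + f 1" if "\<And>i. 2 \<le> i \<Longrightarrow> i < n \<Longrightarrow> f i = (0::real)" for f
  proof -
    have "(\<Sum>i<n. f i) = (\<Sum>i\<in>{0,1}. f i)"
      using n that by (intro sum.mono_neutral_right) auto
    then show ?thesis by simp
  qed
  have P_col: "P *\<^sub>v x = x $ 0 \<cdot>\<^sub>v p1 + x $ 1 \<cdot>\<^sub>v p2"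
    if "x \<in> carrier_vec n" "\<And>i. 2 \<le> i \<Longrightarrow> i < n \<Longrightarrow> x $ i = 0" for x
  proof (rule eq_vecI)
    fix i assume "i < dim_vec (x $ 0 \<cdot>\<^sub>v p1 + x $ 1 \<cdot>\<^sub>v p2)"
    then have i: "i < n" using p12 by simp
    have "(P *\<^sub>v x) $ i = (\<Sum>k<n. P $$ (i, k) * x $ k)"
      using i carr that(1) by (simp add: scalar_prod_def lessThan_atLeast0)
    also have "\<dots> = P $$ (i, 0) * x $ 0 + P $$ (i, 1) * x $ 1"
      using that(2) by (intro two_terms) simp
    finally show "(P *\<^sub>v x) $ i = (x $ 0 \<cdot>\<^sub>v p1 + x $ 1 \<cdot>\<^sub>v p2) $ i"
      using i n carr by (simp add: p1_def p2_def)
  qed (use carr p12 in simp)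
  have colB: "col B j \<in> carrier_vec n" for j using carr by auto
  have Ap1: "A *\<^sub>v p1 = a \<cdot>\<^sub>v p1"
  proof -
    have "P *\<^sub>v col B 0 = a \<cdot>\<^sub>v p1 + 0 \<cdot>\<^sub>v p2"
      using P_col[OF colB[of 0]] n carr ut B00 B10 by (simp add: upper_triangular_def)
    also have "\<dots> = a \<cdot>\<^sub>v p1" using p12 by (intro eq_vecI) auto
    finally show ?thesis using Acol[of 0] n by (simp add: p1_def)
  qed
  have Ap2: "A *\<^sub>v p2 = c \<cdot>\<^sub>v p1 + b \<cdot>\<^sub>v p2"
    using Acol[of 1] P_col[OF colB[of 1]] n carr ut B11
    by (simp add: p2_def c_def upper_triangular_def)
  have indep: "x = 0 \<and> y = 0" if "x \<cdot>\<^sub>v p1 + y \<cdot>\<^sub>v p2 = 0\<^sub>v n" for x y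
  proof -
    define u where "u = vec n (\<lambda>i. if i = 0 then x else if i = 1 then y else 0)"
    have u: "u \<in> carrier_vec n" by (simp add: u_def)
    have u01: "u $ 0 = x" "u $ 1 = y" using n by (simp_all add: u_def)
    have "u $ i = 0" if "2 \<le> i" "i < n" for i using that by (simp add: u_def)
    from P_col[OF u this] have "P *\<^sub>v u = 0\<^sub>v n" unfolding u01 by (simp add: that)
    then have "Q *\<^sub>v (P *\<^sub>v u) = 0\<^sub>v n" using carr by (intro eq_vecI) auto
    moreover have "Q *\<^sub>v (P *\<^sub>v u) = u"
      using assoc_mult_mat_vec[OF carr(3,2) u] BPQ(3) u by simp
    ultimately have "u = 0\<^sub>v n" by simp
    with u01 n show ?thesis by auto
  qed
  define \<alpha> \<beta> where "\<alpha> = p1 \<bullet> p1" and "\<beta> = p1 \<bullet> p2"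
  have p1_nz: "p1 \<noteq> 0\<^sub>v n"
  proof
    assume "p1 = 0\<^sub>v n"
    then have "1 \<cdot>\<^sub>v p1 + 0 \<cdot>\<^sub>v p2 = 0\<^sub>v n" using p12 by (intro eq_vecI) auto
    then show False using indep[of 1 0] by simp
  qed
  then have "\<alpha> \<noteq> 0" using conjugate_square_eq_0_vec[OF p12(1)] by (simp add: \<alpha>_def)
  \<comment> \<open>scaled by \<open>\<alpha>\<close> to avoid a division\<close>
  define q where "q = \<alpha> \<cdot>\<^sub>v p2 - \<beta> \<cdot>\<^sub>v p1"
  have q: "q \<in> carrier_vec n" using p12 by (simp add: q_def)
  have q_alt: "q = (- \<beta>) \<cdot>\<^sub>v p1 + \<alpha> \<cdot>\<^sub>v p2" using p12 by (intro eq_vecI) (auto simp: q_def)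
  have "q \<noteq> 0\<^sub>v n" using indep[of "- \<beta>" \<alpha>] \<open>\<alpha> \<noteq> 0\<close> by (auto simp: q_alt)
  moreover have "p1 \<bullet> q = 0"
    using p12 by (simp add: q_alt scalar_prod_add_distrib[of _ n] \<alpha>_def \<beta>_def)
  moreover have "A *\<^sub>v q = b \<cdot>\<^sub>v q"
  proof -
    have "(A *\<^sub>v p1) \<bullet> p2 = p1 \<bullet> (A *\<^sub>v p2)" by (rule scalar_prod_symmetric_mat[OF A sym p12])
    then have "a * \<beta> = c * \<alpha> + b * \<beta>"
      using p12 by (simp add: Ap1 Ap2 scalar_prod_add_distrib[of _ n] \<alpha>_def \<beta>_def)
    then have eq: "\<alpha> * c = a * \<beta> - b * \<beta>" by simp
    have "A *\<^sub>v q = (- \<beta>) \<cdot>\<^sub>v (A *\<^sub>v p1) + \<alpha> \<cdot>\<^sub>v (A *\<^sub>v p2)"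
      using A p12 by (simp add: q_alt mult_add_distrib_mat_vec mult_mat_vec)
    also have "\<dots> = b \<cdot>\<^sub>v q"
    proof (intro eq_vecI)
      fix i assume "i < dim_vec (b \<cdot>\<^sub>v q)"
      then have i: "i < n" using q by simp
      have "- \<beta> * (a * p1 $ i) + \<alpha> * (c * p1 $ i + b * p2 $ i) = 
          (\<alpha> * c) * p1 $ i - a * \<beta> * p1 $ i + b * \<alpha> * p2 $ i" by (simp add: algebra_simps)
      also have "\<dots> = b * (- \<beta> * p1 $ i + \<alpha> * p2 $ i)" unfolding eq by (simp add: algebra_simps)
      finally show "((- \<beta>) \<cdot>\<^sub>v (A *\<^sub>v p1) + \<alpha> \<cdot>\<^sub>v (A *\<^sub>v p2)) $ i = (b \<cdot>\<^sub>v q) $ i"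
        using p12 i by (simp add: Ap1 Ap2 q_alt)
    qed (use p12 q A in auto)
    finally show ?thesis .
  qed
  ultimately show thesis using that[OF ab p12(1) q p1_nz _ _ Ap1] by blast
qed

text \<open>
  On the span of two orthogonal eigenvectors with positive eigenvalues the form is positive
  definite, but this plane meets the hyperplane orthogonal to \<open>s\<close> in a nonzero vector.
\<close>

lemma num_pos_eigenvalues_le_1:
  fixes A :: "real mat"
  assumes A: "A \<in> carrier_mat n n" and sym: "transpose_mat A = A"
    and s: "s \<in> carrier_vec n"
    and neg: "\<And>x. x \<in> carrier_vec n \<Longrightarrow> s \<bullet> x = 0 \<Longrightarrow> x \<bullet> (A *\<^sub>v x) \<le> 0"
  shows "num_pos_eigenvalues A \<le> 1"
proof (rule ccontr)
  assume "\<not> num_pos_eigenvalues A \<le> 1"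
  then have "2 \<le> num_pos_eigenvalues A" by simp
  then obtain a b p q where ab: "0 < a" "0 < b" and p: "p \<in> carrier_vec n" "p \<noteq> 0\<^sub>v n"
    and q: "q \<in> carrier_vec n" "q \<noteq> 0\<^sub>v n" and orth: "p \<bullet> q = 0"
    and ev: "A *\<^sub>v p = a \<cdot>\<^sub>v p" "A *\<^sub>v q = b \<cdot>\<^sub>v q"
    using two_positive_eigenvalues[OF A sym] by metis
  have orth': "q \<bullet> p = 0" using orth p q by (metis comm_scalar_prod)
  have pp: "0 < p \<bullet> p" "0 < q \<bullet> q"
    using conjugate_square_greater_0_vec[OF p(1)] conjugate_square_greater_0_vec[OF q(1)] p q by auto
  obtain x y where xy: "x \<noteq> 0 \<or> y \<noteq> 0" "x * (s \<bullet> p) + y * (s \<bullet> q) = 0"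
  proof (cases "s \<bullet> p = 0")
    case True
    then show thesis using that[of 1 0] by simp
  next
    case False
    then show thesis using that[of "s \<bullet> q" "- (s \<bullet> p)"] by simp
  qed
  let ?v = "x \<cdot>\<^sub>v p + y \<cdot>\<^sub>v q"
  have "s \<bullet> ?v = 0" using s p q xy(2) by (simp add: scalar_prod_add_distrib[of _ n])
  then have "?v \<bullet> (A *\<^sub>v ?v) \<le> 0" using p q by (intro neg) auto
  moreover have "A *\<^sub>v ?v = (x * a) \<cdot>\<^sub>v p + (y * b) \<cdot>\<^sub>v q"
    using A p q by (simp add: mult_add_distrib_mat_vec mult_mat_vec ev smult_smult_assoc)
  moreover have "?v \<bullet> ((x * a) \<cdot>\<^sub>v p + (y * b) \<cdot>\<^sub>v q) = a * x\<^sup>2 * (p \<bullet> p) + b * y\<^sup>2 * (q \<bullet> q)"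
    using p q orth orth'
    by (simp add: scalar_prod_add_distrib[of _ n] add_scalar_prod_distrib[of _ n] power2_eq_square)
  moreover have "0 < a * x\<^sup>2 * (p \<bullet> p) + b * y\<^sup>2 * (q \<bullet> q)"
    using ab pp xy(1) by (auto intro: add_pos_nonneg add_nonneg_pos)
  ultimately show False by simp
qed

definition mat_trace :: "'a :: comm_monoid_add mat \<Rightarrow> 'a" where
  "mat_trace A = (\<Sum>i<dim_row A. A $$ (i, i))"

lemma mat_trace_mult_commute:
  fixes A :: "'a :: comm_semiring_0 mat"
  assumes "A \<in> carrier_mat n n" "B \<in> carrier_mat n n"
  shows "mat_trace (A * B) = mat_trace (B * A)"
proof -
  have tr: "mat_trace (X * Y) = (\<Sum>i<n. \<Sum>j<n. X $$ (i, j) * Y $$ (j, i))"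
    if "X \<in> carrier_mat n n" "Y \<in> carrier_mat n n" for X Y :: "'a mat"
    using that by (auto simp: mat_trace_def scalar_prod_def lessThan_atLeast0 intro!: sum.cong)
  show ?thesis
    unfolding tr[OF assms] tr[OF assms(2,1)]
    by (subst sum.swap) (simp add: mult.commute)
qed

text \<open>
  If no eigenvalue were positive, trace zero would force all of them to be zero. A triangular form
  of \<open>A\<close> would then have zero diagonal, so the trace of \<open>A\<^sup>2\<close> would vanish. But that trace is the
  sum of the squares of the entries of \<open>A\<close>.
\<close>

lemma num_pos_eigenvalues_pos:
  fixes A :: "real mat"
  assumes A: "A \<in> carrier_mat n n" and sym: "transpose_mat A = A"
    and tr: "mat_trace A = 0" and nz: "i < n" "j < n" "A $$ (i, j) \<noteq> 0"
  shows "1 \<le> num_pos_eigenvalues A"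
proof (rule ccontr)
  assume none: "\<not> 1 \<le> num_pos_eigenvalues A"
  obtain es where es: "char_poly A = (\<Prod>e\<leftarrow>es. [:- e, 1:])"
    using char_poly_symmetric_real_splits[OF A sym] .
  with none num_pos_eigenvalues_eq_length[OF A es] have "length (filter (\<lambda>e. 0 < e) es) = 0"
    by linarith
  then have nonpos: "e \<le> 0" if "e \<in> set es" for e
    using that by (auto simp: filter_empty_conv not_less)
  obtain B P Q where BPQ: "A = P * B * Q" "P * Q = 1\<^sub>m n" "Q * P = 1\<^sub>m n"
      and carr: "B \<in> carrier_mat n n" "P \<in> carrier_mat n n" "Q \<in> carrier_mat n n"
      and ut: "upper_triangular B" and dB: "diag_mat B = es"
    using schur_decomposition_obtain[OF A es] .
  have QP: "Q * (P * M) = M" if M: "M \<in> carrier_mat n n" for M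
    using assoc_mult_mat[OF carr(3,2) M] BPQ(3) M by simp
  have conj: "mat_trace (P * M * Q) = mat_trace M" if M: "M \<in> carrier_mat n n" for M
  proof -
    have "mat_trace (P * M * Q) = mat_trace (Q * (P * M))"
      using carr M by (intro mat_trace_mult_commute) auto
    also have "Q * (P * M) = M" by (rule QP[OF M])
    finally show ?thesis .
  qed
  have B_nonpos: "B $$ (k, k) \<le> 0" if "k < n" for k
    using nonpos[of "B $$ (k, k)"] carr that unfolding dB[symmetric] by (auto simp: diag_mat_def)
  have "(\<Sum>k<n. - (B $$ (k, k))) = 0"
    using conj[OF carr(1)] tr carr BPQ(1) by (simp add: mat_trace_def sum_negf)
  then have B_diag: "B $$ (k, k) = 0" if "k < n" for k
    using sum_nonneg_eq_0_iff[of "{..<n}" "\<lambda>k. - (B $$ (k, k))"] B_nonpos that by auto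
  have "A * A = P * (B * B) * Q"
  proof -
    have "A * A = P * B * (Q * (P * (B * Q)))"
      unfolding BPQ(1) using carr by (simp add: assoc_mult_mat[of _ n n _ n _ n])
    also have "Q * (P * (B * Q)) = B * Q" using carr by (intro QP) simp
    also have "P * B * (B * Q) = P * (B * B) * Q"
      using carr by (simp add: assoc_mult_mat[of _ n n _ n _ n])
    finally show ?thesis .
  qed
  then have "mat_trace (A * A) = mat_trace (B * B)" using conj[of "B * B"] carr by simp
  also have "\<dots> = 0"
  proof -
    have "B $$ (k, l) * B $$ (l, k) = 0" if "k < n" "l < n" for k l
      using ut B_diag carr that by (cases k l rule: linorder_cases) (auto simp: upper_triangular_def)
    then show ?thesis using carr
      by (auto simp: mat_trace_def scalar_prod_def intro!: sum.neutral)
  qed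
  finally have tr0: "mat_trace (A * A) = 0" .
  have "A $$ (l, k) = A $$ (k, l)" if "k < n" "l < n" for k l
    using arg_cong[OF sym, of "\<lambda>M. M $$ (k, l)"] A that by simp
  then have "mat_trace (A * A) = (\<Sum>k<n. \<Sum>l<n. (A $$ (k, l))\<^sup>2)"
    using A by (auto simp: mat_trace_def scalar_prod_def power2_eq_square lessThan_atLeast0 intro!: sum.cong)
  with tr0 have "(\<Sum>k<n. \<Sum>l<n. (A $$ (k, l))\<^sup>2) = 0" by simp
  then have "(A $$ (i, j))\<^sup>2 = 0"
    using nz by (simp add: sum_nonneg_eq_0_iff sum_nonneg)
  with nz show False by simp
qed

section \<open>The distance matrix\<close>

theorem theorem3p3:
  fixes G :: "('a, 'b) pre_digraph" and vs :: "'a list"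
  assumes "graph G"
    and "Digraph_Component.connected G"
    and "2 \<le> card (verts G)"
    and "\<And>B. block G B \<Longrightarrow> negative_type (verts B) (graph_dist B)"
    and "distinct vs" and "set vs = verts G"
  shows "num_pos_eigenvalues (distance_matrix G vs) = 1"
proof (rule order.antisym)
  interpret graph G by fact
  let ?n = "length vs" and ?D = "distance_matrix G vs"
  have D: "?D \<in> carrier_mat ?n ?n" by (simp add: distance_matrix_def)
  have vs: "vs ! i \<in> verts G" if "i < ?n" for i using nth_mem[OF that] unfolding assms(6) .
  have D_index: "?D $$ (i, j) = graph_dist G (vs ! i) (vs ! j)" if "i < ?n" "j < ?n" for i j
    using that by (simp add: distance_matrix_def)
  have sym: "transpose_mat ?D = ?D"
    using D by (intro eq_matI) (auto simp: D_index graph_dist_commute[OF assms(2)] vs)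
  \<comment> \<open>with \<open>s\<close> the all-ones vector, the hyperplane consists of the weights of total zero\<close>
  show "num_pos_eigenvalues ?D \<le> 1"
  proof (rule num_pos_eigenvalues_le_1[OF D sym])
    show "vec ?n (\<lambda>_. 1) \<in> carrier_vec ?n" by simp
    fix x :: "real vec" assume x: "x \<in> carrier_vec ?n" and sum0: "vec ?n (\<lambda>_. 1) \<bullet> x = 0"
    have bij: "bij_betw ((!) vs) {..<?n} (verts G)"
      using bij_betw_nth[OF assms(5) refl assms(6)[symmetric]] .
    \<comment> \<open>the vector \<open>x\<close>, read as a weight function on the vertices\<close>
    define w where "w u = x $ (inv_into {..<?n} ((!) vs) u)" for u
    have w: "w (vs ! i) = x $ i" if "i < ?n" for i
      using that bij by (simp add: w_def inv_into_f_f bij_betw_imp_inj_on)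
    have "(\<Sum>u\<in>verts G. w u) = (\<Sum>i<?n. x $ i)"
      unfolding sum.reindex_bij_betw[OF bij, of w, symmetric] by (simp add: w)
    also have "\<dots> = 0" using x sum0 by (simp add: scalar_prod_def lessThan_atLeast0)
    finally have "(\<Sum>u\<in>verts G. \<Sum>u'\<in>verts G. w u * w u' * graph_dist G u u') \<le> 0"
      by (intro negative_type_real_weights negative_type_of_blocks assms) auto
    moreover have "(\<Sum>u\<in>verts G. \<Sum>u'\<in>verts G. w u * w u' * graph_dist G u u') = x \<bullet> (?D *\<^sub>v x)"
    proof -
      have "(\<Sum>u\<in>verts G. \<Sum>u'\<in>verts G. w u * w u' * graph_dist G u u') =
          (\<Sum>i<?n. \<Sum>j<?n. x $ i * x $ j * ?D $$ (i, j))"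
        unfolding sum.reindex_bij_betw[OF bij, symmetric] by (simp add: w D_index)
      also have "\<dots> = x \<bullet> (?D *\<^sub>v x)"
        using x D by (simp add: scalar_prod_def lessThan_atLeast0 sum_distrib_left mult_ac)
      finally show ?thesis .
    qed
    ultimately show "x \<bullet> (?D *\<^sub>v x) \<le> 0" by simp
  qed
  have "2 \<le> ?n" using assms(3,5,6) distinct_card by metis
  then have lt: "0 < ?n" "1 < ?n" by auto
  have "vs ! 0 \<noteq> vs ! 1" using nth_eq_iff_index_eq[OF assms(5) lt] by simp
  then have "?D $$ (0, 1) \<noteq> 0"
    using graph_dist_pos[OF assms(2) vs[OF lt(1)] vs[OF lt(2)]] D_index[OF lt] by simp
  moreover have "mat_trace ?D = 0"
    using D by (simp add: mat_trace_def D_index graph_dist_self vs)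
  ultimately show "1 \<le> num_pos_eigenvalues ?D" using num_pos_eigenvalues_pos[OF D sym _ lt] by blast
qed

end
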